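(* For every positive integer $k$ there exists a CIS graph $G_k$ such that $|V(G_k)| > k\cdot \alpha(G_k)\cdot \omega(G_k)$.
   Context: All graphs are finite and simple. A graph is CIS if every inclusion-maximal clique intersects every inclusion-maximal stable set. $\alpha(G)$ is the maximum size of a stable set and $\omega(G)$ the maximum size of a clique in $G$. *)

theory Defs
  imports "HOL-Library.Ramsey"
begin

text \<open>
  A graph is a vertex set \<open>V\<close> together with a set \<open>E\<close> of two-element subsets of \<open>V\<close>.
  The predicates \<^const>\<open>clique\<close> and \<^const>\<open>indep\<close> of \<^theory>\<open>HOL-Library.Ramsey\<close> take the
  candidate clique or stable set as first argument and the edge set as second; they do not
  restrict it to lie in \<open>V\<close>, so this is required separately below.
\<close>

definition finite_simple_graph :: "'a set \<Rightarrow> 'a set set \<Rightarrow> bool" where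
  "finite_simple_graph V E \<longleftrightarrow> finite V \<and> E \<subseteq> nsets V 2"

definition maximal_clique :: "'a set \<Rightarrow> 'a set set \<Rightarrow> 'a set \<Rightarrow> bool" where
  "maximal_clique V E C \<longleftrightarrow>
     C \<subseteq> V \<and> clique C E \<and> (\<forall>D. D \<subseteq> V \<and> clique D E \<and> C \<subseteq> D \<longrightarrow> D = C)"

definition maximal_stable_set :: "'a set \<Rightarrow> 'a set set \<Rightarrow> 'a set \<Rightarrow> bool" where
  "maximal_stable_set V E S \<longleftrightarrow>
     S \<subseteq> V \<and> indep S E \<and> (\<forall>T. T \<subseteq> V \<and> indep T E \<and> S \<subseteq> T \<longrightarrow> T = S)"

definition CIS :: "'a set \<Rightarrow> 'a set set \<Rightarrow> bool" where
  "CIS V E \<longleftrightarrow>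
     (\<forall>C S. maximal_clique V E C \<and> maximal_stable_set V E S \<longrightarrow> C \<inter> S \<noteq> {})"

definition stability_number :: "'a set \<Rightarrow> 'a set set \<Rightarrow> nat" where
  "stability_number V E = Max {card S |S. S \<subseteq> V \<and> indep S E}"

definition clique_number :: "'a set \<Rightarrow> 'a set set \<Rightarrow> nat" where
  "clique_number V E = Max {card C |C. C \<subseteq> V \<and> clique C E}"

end

theory Submission
  imports Defs Complex_Main "HOL-Library.Countable"
begin

text \<open>
  Substituting CIS graphs for the vertices of a CIS graph yields a CIS graph. Hence
  lexicographic powers raise the ratio \<open>|V| / (\<alpha> \<omega>)\<close> to arbitrary powers, and it suffices to
  find one CIS graph with \<open>|V| > \<alpha> \<omega>\<close>. Attach a simplicial vertex to every edge of the
  5-cycle: every maximal clique then contains the closed neighbourhood of one of its vertices, so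
  the graph is CIS. Substituting the disjoint union of \<open>N\<close> copies of \<open>K\<^sub>N\<close> for each vertex of the
  cycle gives \<open>5 N\<^sup>2 + 5\<close> vertices, while cliques and stable sets have at most \<open>2 N + 5\<close>
  vertices.
\<close>

section \<open>Maximal cliques, maximal stable sets and substitution\<close>

text \<open>
  Graphs are given by adjacency predicates whose values on the diagonal are irrelevant, so that
  negating the predicate exchanges cliques and stable sets.
\<close>

definition max_pairwise :: "'a set \<Rightarrow> ('a \<Rightarrow> 'a \<Rightarrow> bool) \<Rightarrow> 'a set \<Rightarrow> bool" where
  "max_pairwise V A C \<longleftrightarrow> C \<subseteq> V \<and> pairwise A C \<and> (\<forall>x\<in>V - C. \<exists>y\<in>C. \<not> A x y)"

definition cis_on :: "'a set \<Rightarrow> ('a \<Rightarrow> 'a \<Rightarrow> bool) \<Rightarrow> bool" where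
  "cis_on V A \<longleftrightarrow>
     (\<forall>C S. max_pairwise V A C \<longrightarrow> max_pairwise V (\<lambda>x y. \<not> A x y) S \<longrightarrow> C \<inter> S \<noteq> {})"

text \<open>\<open>s\<close> bounds stable sets and \<open>w\<close> bounds cliques from above,
  which is what a lower bound on the ratio of \<open>card V\<close> to their product calls
  for.\<close>

definition bounded_cis :: "'a set \<Rightarrow> ('a \<Rightarrow> 'a \<Rightarrow> bool) \<Rightarrow> nat \<Rightarrow> nat \<Rightarrow> bool" where
  "bounded_cis V A s w \<longleftrightarrow> finite V \<and> symp A \<and> cis_on V A \<and>
     (\<forall>C\<subseteq>V. pairwise A C \<longrightarrow> card C \<le> w) \<and>
     (\<forall>S\<subseteq>V. pairwise (\<lambda>x y. \<not> A x y) S \<longrightarrow> card S \<le> s)"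

text \<open>Here \<open>p\<close> collapses a graph obtained by substituting a graph for each vertex
  of \<open>V\<close>. Non-relation between distinct fibres descends along \<open>p\<close>, which
  gives maximality downstairs. The relation is arbitrary, so this serves for cliques and, after
  negation, for stable sets.\<close>

lemma max_pairwise_quotient:
  assumes C: "max_pairwise V' A' C" and onto: "p ` V' = V"
    and adj: "\<And>x y. x \<in> V' \<Longrightarrow> y \<in> V' \<Longrightarrow> p x \<noteq> p y \<Longrightarrow> A' x y = A (p x) (p y)"
  shows "max_pairwise V A (p ` C)"
    and "v \<in> p ` C \<Longrightarrow> max_pairwise {x \<in> V'. p x = v} A' {x \<in> C. p x = v}"
proof -
  have CV: "C \<subseteq> V'" and pw: "pairwise A' C"
    and mx: "\<And>x. x \<in> V' \<Longrightarrow> x \<notin> C \<Longrightarrow> \<exists>y\<in>C. \<not> A' x y"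
    using C by (auto simp: max_pairwise_def)
  have pwA: "A (p x) (p y)" if "x \<in> C" "y \<in> C" "p x \<noteq> p y" for x y
    using that pw CV adj by (metis pairwiseD subsetD)
  show "max_pairwise V A (p ` C)"
    unfolding max_pairwise_def
  proof (intro conjI ballI)
    show "p ` C \<subseteq> V" using CV onto by auto
    show "pairwise A (p ` C)" using pwA by (auto simp: pairwise_def)
    fix v assume v: "v \<in> V - p ` C"
    then obtain x where x: "x \<in> V'" "p x = v" using onto by auto
    then obtain y where y: "y \<in> C" "\<not> A' x y" using mx v by blast
    have "p x \<noteq> p y" using v x y by auto
    with x y adj CV have "\<not> A v (p y)" by (metis subsetD)
    then show "\<exists>u\<in>p ` C. \<not> A v u" using y by auto
  qed
  assume v: "v \<in> p ` C"
  then obtain c where c: "c \<in> C" "p c = v" by auto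
  show "max_pairwise {x \<in> V'. p x = v} A' {x \<in> C. p x = v}"
    unfolding max_pairwise_def
  proof (intro conjI ballI)
    show "{x \<in> C. p x = v} \<subseteq> {x \<in> V'. p x = v}" using CV by auto
    show "pairwise A' {x \<in> C. p x = v}" using pw by (auto simp: pairwise_def)
    fix x assume x: "x \<in> {x \<in> V'. p x = v} - {x \<in> C. p x = v}"
    then obtain y where y: "y \<in> C" "\<not> A' x y" using mx by blast
    \<comment> \<open>\<open>c\<close> is related to every member of \<open>C\<close> outside its
      fibre, hence so is \<open>x\<close>; the obstruction \<open>y\<close> must lie in the
      fibre.\<close>
    have "p y = v"
    proof (rule ccontr)
      assume ne: "p y \<noteq> v"
      then have "A (p c) (p y)" using pwA c y by auto
      moreover have "A' x y = A (p x) (p y)" using adj x y CV ne by auto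
      ultimately show False using x c y by auto
    qed
    then show "\<exists>y\<in>{x \<in> C. p x = v}. \<not> A' x y" using y by auto
  qed
qed

text \<open>The two projections share some \<open>v\<close> because the base is CIS; the traces on
  the fibre over \<open>v\<close> are maximal there and meet because the fibre is CIS.\<close>

lemma cis_on_quotient:
  assumes cis: "cis_on V A" and onto: "p ` V' = V"
    and adj: "\<And>x y. x \<in> V' \<Longrightarrow> y \<in> V' \<Longrightarrow> p x \<noteq> p y \<Longrightarrow> A' x y = A (p x) (p y)"
    and fib: "\<And>v. v \<in> V \<Longrightarrow> cis_on {x \<in> V'. p x = v} A'"
  shows "cis_on V' A'"
  unfolding cis_on_def
proof (intro allI impI)
  fix C S
  assume C: "max_pairwise V' A' C" and S: "max_pairwise V' (\<lambda>x y. \<not> A' x y) S"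
  have adj': "\<And>x y. x \<in> V' \<Longrightarrow> y \<in> V' \<Longrightarrow> p x \<noteq> p y \<Longrightarrow> (\<not> A' x y) = (\<not> A (p x) (p y))"
    using adj by blast
  note qC = max_pairwise_quotient[where A = A, OF C onto adj]
  note qS = max_pairwise_quotient[where A = "\<lambda>x y. \<not> A x y", OF S onto adj']
  obtain v where v: "v \<in> p ` C" "v \<in> p ` S"
    using cis qC(1) qS(1) unfolding cis_on_def by (metis disjoint_iff)
  moreover have "v \<in> V" using v(1) C onto by (auto simp: max_pairwise_def)
  ultimately have "{x \<in> C. p x = v} \<inter> {x \<in> S. p x = v} \<noteq> {}"
    using fib qC(2) qS(2) unfolding cis_on_def by blast
  then show "C \<inter> S \<noteq> {}" by auto
qed

lemma cis_on_singleton: "cis_on {x :: 'a} A"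
proof -
  have "C = {x}" if "max_pairwise {x} R C" for R and C :: "'a set"
    using that by (auto simp: max_pairwise_def)
  then show ?thesis unfolding cis_on_def by blast
qed

text \<open>An isomorphism is a substitution in which every fibre is a single vertex.\<close>

lemma cis_on_inj:
  assumes "cis_on V A" and "p ` V' = V" and inj: "inj_on p V'"
    and "\<And>x y. x \<in> V' \<Longrightarrow> y \<in> V' \<Longrightarrow> A' x y = A (p x) (p y)"
  shows "cis_on V' A'"
proof (rule cis_on_quotient[where p = p, OF assms(1,2)])
  fix v assume "v \<in> V"
  then obtain x where "x \<in> V'" "p x = v" using assms(2) by auto
  then have "{x \<in> V'. p x = v} = {x}" using inj by (auto dest: inj_onD)
  then show "cis_on {x \<in> V'. p x = v} A'" by (simp add: cis_on_singleton)
qed (use assms(4) in auto)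

text \<open>\<open>C\<close> is counted fibre by fibre: its image is pairwise related in the base,
  and the fibre over \<open>v\<close> contributes at most \<open>f v\<close>. The weight depends on
  \<open>v\<close> because the blow-up has fibres of two sizes.\<close>

lemma card_pairwise_quotient_le:
  assumes fin: "finite V'" and C: "C \<subseteq> V'" "pairwise A' C" and onto: "p ` V' = V"
    and adj: "\<And>x y. x \<in> V' \<Longrightarrow> y \<in> V' \<Longrightarrow> p x \<noteq> p y \<Longrightarrow> A' x y = A (p x) (p y)"
    and fib: "\<And>v D. v \<in> V \<Longrightarrow> D \<subseteq> {x \<in> V'. p x = v} \<Longrightarrow> pairwise A' D \<Longrightarrow> card D \<le> f v"
    and sum: "\<And>D. D \<subseteq> V \<Longrightarrow> pairwise A D \<Longrightarrow> sum f D \<le> b"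
  shows "card C \<le> b"
proof -
  have finC: "finite C" using fin C finite_subset by blast
  have "card C = (\<Sum>v\<in>p ` C. card {x \<in> C. p x = v})"
    using sum.group[of C "p ` C" p "\<lambda>_. 1::nat"] finC by simp
  also have "\<dots> \<le> sum f (p ` C)"
  proof (rule sum_mono)
    fix v assume "v \<in> p ` C"
    then show "card {x \<in> C. p x = v} \<le> f v"
      using C onto by (intro fib) (auto simp: pairwise_def)
  qed
  also have "\<dots> \<le> b"
  proof (rule sum)
    show "p ` C \<subseteq> V" using C onto by auto
    show "pairwise A (p ` C)"
      using C adj unfolding pairwise_def by (metis (no_types, lifting) imageE subsetD)
  qed
  finally show ?thesis .
qed

section \<open>Isomorphic copies, lexicographic products and powers\<close>

lemma bounded_cis_inj:
  assumes G: "bounded_cis V A s w" and onto: "p ` V' = V" and inj: "inj_on p V'"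
    and adj: "\<And>x y. A' x y = A (p x) (p y)"
  shows "bounded_cis V' A' s w"
proof -
  have card: "card C \<le> b"
    if "C \<subseteq> V'" "pairwise (\<lambda>x y. R (p x) (p y)) C"
      and "\<forall>D\<subseteq>V. pairwise R D \<longrightarrow> card D \<le> b" for C R b
  proof -
    have "pairwise R (p ` C)" using that(2) by (auto simp: pairwise_def)
    moreover have "p ` C \<subseteq> V" using that(1) onto by auto
    moreover have "card (p ` C) = card C"
      using inj that(1) by (meson card_image inj_on_subset)
    ultimately show ?thesis using that(3) by metis
  qed
  have A': "A' = (\<lambda>x y. A (p x) (p y))" using adj by auto
  have "cis_on V A" "finite V" using G by (simp_all add: bounded_cis_def)
  then have "cis_on V' A'" "finite V'"
    using cis_on_inj[of V A p V' A', OF _ onto inj adj] finite_imageD[OF _ inj] onto by auto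
  moreover have "symp A'" using G by (auto simp: bounded_cis_def A' symp_def)
  ultimately show ?thesis
    using G card[of _ A w] card[of _ "\<lambda>x y. \<not> A x y" s]
    unfolding bounded_cis_def A' by auto
qed

text \<open>Both bounds multiply because a clique meets at most \<open>w\<close> fibres, each in at
  most \<open>w'\<close> vertices, and likewise for stable sets.\<close>

lemma bounded_cis_lex:
  assumes G: "bounded_cis V A s w" and H: "bounded_cis W B s' w'"
  shows "bounded_cis (V \<times> W)
    (\<lambda>x y. if fst x = fst y then B (snd x) (snd y) else A (fst x) (fst y)) (s * s') (w * w')"
    (is "bounded_cis ?U ?R _ _")
proof (cases "W = {}")
  case True
  \<comment> \<open>On the empty vertex set the empty clique and the empty stable set are both
    maximal, and they are disjoint.\<close>
  then have "\<not> cis_on W B" by (auto simp: cis_on_def max_pairwise_def)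
  then show ?thesis using H by (simp add: bounded_cis_def)
next
  case False
  then have onto: "fst ` ?U = V" by auto
  have fin: "finite ?U" using G H by (auto simp: bounded_cis_def)
  have finV: "finite V" using G by (auto simp: bounded_cis_def)
  have card: "card C \<le> b * b'"
    if C: "C \<subseteq> ?U"
      "pairwise (\<lambda>x y. if fst x = fst y then Q (snd x) (snd y) else P (fst x) (fst y)) C"
      and P: "\<forall>D\<subseteq>V. pairwise P D \<longrightarrow> card D \<le> b"
      and Q: "\<forall>D\<subseteq>W. pairwise Q D \<longrightarrow> card D \<le> b'" for C P Q b b'
  proof (rule card_pairwise_quotient_le[where p = fst and A = P and f = "\<lambda>_. b'",
        OF fin C onto])
    fix v D assume D: "D \<subseteq> {x \<in> ?U. fst x = v}"
      "pairwise (\<lambda>x y. if fst x = fst y then Q (snd x) (snd y) else P (fst x) (fst y)) D"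
    have "inj_on snd D" using D(1) by (intro inj_onI) (auto simp: prod_eq_iff)
    moreover have "pairwise Q (snd ` D)"
      unfolding pairwise_image
    proof (rule pairwiseI, intro impI)
      fix x y assume xy: "x \<in> D" "y \<in> D" "x \<noteq> y"
      then have "fst x = v" "fst y = v" using D(1) by blast+
      then show "Q (snd x) (snd y)" using pairwiseD[OF D(2) xy] by simp
    qed
    moreover have "snd ` D \<subseteq> W" using D(1) by auto
    ultimately show "card D \<le> b'" using Q card_image by metis
  next
    fix D assume "D \<subseteq> V" "pairwise P D"
    then show "(\<Sum>v\<in>D. b') \<le> b * b'" using P by simp
  qed auto
  have "cis_on ?U ?R"
  proof (rule cis_on_quotient[where p = fst and A = A, OF _ onto])
    show "cis_on V A" using G by (simp add: bounded_cis_def)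
    fix v assume v: "v \<in> V"
    show "cis_on {x \<in> ?U. fst x = v} ?R"
    proof (rule cis_on_inj[where p = snd and A = B])
      show "cis_on W B" using H by (simp add: bounded_cis_def)
      show "snd ` {x \<in> ?U. fst x = v} = W" using v by force
      show "inj_on snd {x \<in> ?U. fst x = v}" by (auto simp: inj_on_def)
    qed auto
  qed auto
  moreover have "symp ?R" using G H by (auto simp: bounded_cis_def symp_def)
  moreover have "card C \<le> w * w'" if "C \<subseteq> ?U" "pairwise ?R C" for C
    using that card[of C B A w w'] G H by (simp add: bounded_cis_def)
  moreover have "card C \<le> s * s'" if "C \<subseteq> ?U" "pairwise (\<lambda>x y. \<not> ?R x y) C" for C
  proof -
    \<comment> \<open>Complementation commutes with the lexicographic product, so the same count
      applies to the complements.\<close>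
    have eq: "(\<lambda>x y. \<not> ?R x y) = (\<lambda>x y. if fst x = fst y then \<not> B (snd x) (snd y)
        else \<not> A (fst x) (fst y))" by auto
    show ?thesis
      using that card[of C "\<lambda>x y. \<not> B x y" "\<lambda>x y. \<not> A x y" s s'] G H
      unfolding eq by (simp add: bounded_cis_def)
  qed
  ultimately show ?thesis using fin unfolding bounded_cis_def by auto
qed

text \<open>Each product has pairs as vertices; recoding them as numbers keeps all powers in one
  type, so that induction on the exponent is possible.\<close>

lemma bounded_cis_nat:
  fixes V :: "'a::countable set"
  assumes "bounded_cis V A s w"
  shows "\<exists>(V' :: nat set) A'. bounded_cis V' A' s w \<and> card V' = card V"
proof (intro exI conjI)
  show "bounded_cis (to_nat ` V) (\<lambda>x y. A (from_nat x) (from_nat y)) s w"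
    by (rule bounded_cis_inj[where p = from_nat, OF assms])
      (auto simp: inj_on_def image_image)
  show "card (to_nat ` V) = card V" by (simp add: card_image)
qed

lemma bounded_cis_power:
  fixes V :: "nat set"
  assumes G: "bounded_cis V A s w"
  shows "\<exists>(V' :: nat set) A'. bounded_cis V' A' (s ^ t) (w ^ t) \<and> card V' = card V ^ t"
proof (induction t)
  case 0
  have "card C \<le> 1" if "C \<subseteq> {0::nat}" for C
    using card_mono[OF _ that] by simp
  then have "bounded_cis {0::nat} (\<lambda>_ _. False) 1 1"
    by (auto simp: bounded_cis_def cis_on_singleton symp_def)
  then show ?case by (intro exI[of _ "{0}"]) auto
next
  case (Suc t)
  then obtain V' :: "nat set" and A' where
    "bounded_cis V' A' (s ^ t) (w ^ t)" and c: "card V' = card V ^ t" by blast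
  from bounded_cis_nat[OF bounded_cis_lex[OF G this(1)]] c
  show ?case by (simp add: card_cartesian_product)
qed

section \<open>The 5-cycle with simplicial vertices\<close>

lemma cis_on_simplicial:
  assumes "symp A"
    and simplicial: "\<And>C. max_pairwise V A C \<Longrightarrow> \<exists>x\<in>C. \<forall>y\<in>V. A x y \<longrightarrow> y \<in> C"
  shows "cis_on V A"
  unfolding cis_on_def
proof (intro allI impI)
  fix C S
  assume C: "max_pairwise V A C" and S: "max_pairwise V (\<lambda>x y. \<not> A x y) S"
  obtain x where x: "x \<in> C" "\<forall>y\<in>V. A x y \<longrightarrow> y \<in> C" using simplicial[OF C] by blast
  then have "x \<in> V" using C by (auto simp: max_pairwise_def)
  \<comment> \<open>If \<open>S\<close> misses \<open>x\<close>, maximality gives it a neighbour of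
    \<open>x\<close>, and all neighbours of \<open>x\<close> lie in \<open>C\<close>.\<close>
  then have "x \<in> S \<or> (\<exists>y\<in>S. A x y)" using S by (auto simp: max_pairwise_def)
  then show "C \<inter> S \<noteq> {}" using x S by (auto simp: max_pairwise_def)
qed

definition cycle5 :: "nat \<Rightarrow> nat \<Rightarrow> bool" where
  "cycle5 u v \<longleftrightarrow> v = (u + 1) mod 5 \<or> u = (v + 1) mod 5"

text \<open>The simplicial vertex attached to the edge between \<open>i\<close> and \<open>i + 1 mod 5\<close> is \<open>i + 5\<close>.\<close>

definition sun5 :: "nat \<Rightarrow> nat \<Rightarrow> bool" where
  "sun5 u v \<longleftrightarrow> (if u < 5 then if v < 5 then cycle5 u v else u = v - 5 \<or> u = (v - 4) mod 5
     else v < 5 \<and> (v = u - 5 \<or> v = (u - 4) mod 5))"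

lemma symp_sun5: "symp sun5"
  unfolding symp_def sun5_def cycle5_def by auto

text \<open>This is the colouring that shows \<open>R(3,3) > 5\<close>, checked on all triples. It
  limits cliques and stable sets to two cycle vertices, hence to two large fibres of the
  blow-up.\<close>

lemma cycle5_triple:
  assumes "u < 5" "v < 5" "w < 5" "u \<noteq> v" "u \<noteq> w" "v \<noteq> w"
  shows "\<not> (cycle5 u v \<and> cycle5 u w \<and> cycle5 v w)"
    and "cycle5 u v \<or> cycle5 u w \<or> cycle5 v w"
proof -
  have "\<forall>u\<in>{0,1,2,3,4}. \<forall>v\<in>{0,1,2,3,4}. \<forall>w\<in>{0,1,2,3,4}.
      u \<noteq> v \<longrightarrow> u \<noteq> w \<longrightarrow> v \<noteq> w \<longrightarrow>
      \<not> (cycle5 u v \<and> cycle5 u w \<and> cycle5 v w) \<and> (cycle5 u v \<or> cycle5 u w \<or> cycle5 v w)"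
    by (simp add: cycle5_def)
  moreover have "u \<in> {0,1,2,3,4}" "v \<in> {0,1,2,3,4}" "w \<in> {0,1,2,3,4}" using assms(1-3) by auto
  ultimately have "\<not> (cycle5 u v \<and> cycle5 u w \<and> cycle5 v w) \<and>
      (cycle5 u v \<or> cycle5 u w \<or> cycle5 v w)"
    using assms(4-6) by blast
  then show "\<not> (cycle5 u v \<and> cycle5 u w \<and> cycle5 v w)"
    and "cycle5 u v \<or> cycle5 u w \<or> cycle5 v w"
    by blast+
qed

lemma card_le_2_if_no_triple:
  assumes "\<And>u v w. u \<in> C \<Longrightarrow> v \<in> C \<Longrightarrow> w \<in> C \<Longrightarrow> u \<noteq> v \<Longrightarrow> u \<noteq> w \<Longrightarrow> v \<noteq> w \<Longrightarrow> False"
  shows "card C \<le> 2"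
proof (rule ccontr)
  assume "\<not> card C \<le> 2"
  then obtain T where "T \<subseteq> C" "card T = 3"
    using obtain_subset_with_card_n[of 3 C] by auto
  then obtain u v w where "T = {u, v, w}" "u \<noteq> v" "u \<noteq> w" "v \<noteq> w"
    by (auto simp: card_3_iff)
  then show False using assms[of u v w] \<open>T \<subseteq> C\<close> by auto
qed

text \<open>A clique of a triangle-free graph has at most two vertices. Containment in an edge also
  covers the empty set and singletons, and it names the edge whose attached vertex extends the
  clique.\<close>

lemma sun5_clique_in_cycle:
  assumes C: "C \<subseteq> {..<5}" "pairwise sun5 C"
  shows "\<exists>i<5. C \<subseteq> {i, (i + 1) mod 5}"
proof (cases "\<exists>u\<in>C. \<exists>v\<in>C. u \<noteq> v")
  case no_pair: False
  show ?thesis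
  proof (cases "C = {}")
    case False
    then obtain u where "u \<in> C" by auto
    then show ?thesis using no_pair C by (intro exI[of _ u]) auto
  qed (auto intro: exI[of _ 0])
next
  case True
  then obtain u v where uv: "u \<in> C" "v \<in> C" "u \<noteq> v" by auto
  have adj: "cycle5 x y" if "x \<in> C" "y \<in> C" "x \<noteq> y" for x y
    using C pairwiseD[OF C(2) that] that by (auto simp: sun5_def subset_iff)
  have "C \<subseteq> {u, v}"
  proof
    fix w assume "w \<in> C"
    then show "w \<in> {u, v}"
      using cycle5_triple(1)[of u v w] adj uv C(1) by (auto simp: subset_iff)
  qed
  moreover have "v = (u + 1) mod 5 \<or> u = (v + 1) mod 5"
    using adj[OF uv] by (simp add: cycle5_def)
  ultimately show ?thesis using uv C(1) by (auto simp: subset_iff)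
qed

lemma cis_on_sun5: "cis_on {..<10} sun5"
proof (rule cis_on_simplicial[OF symp_sun5])
  fix C assume C: "max_pairwise {..<10} sun5 C"
  have sub: "C \<subseteq> {..<10}" and pw: "pairwise sun5 C"
    and mx: "\<And>x. x < 10 \<Longrightarrow> x \<notin> C \<Longrightarrow> \<exists>y\<in>C. \<not> sun5 x y"
    using C by (auto simp: max_pairwise_def)
  \<comment> \<open>A clique inside the cycle lies in an edge, and the vertex \<open>i + 5\<close>
    attached to that edge could be added.\<close>
  have "\<exists>x\<in>C. 5 \<le> x"
  proof (rule ccontr)
    assume neg: "\<not> (\<exists>x\<in>C. 5 \<le> x)"
    then have "C \<subseteq> {..<5}" by (auto simp: not_le)
    then obtain i where i: "i < 5" "C \<subseteq> {i, (i + 1) mod 5}"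
      using sun5_clique_in_cycle pw by blast
    then have "i + 5 \<notin> C" using neg by auto
    then obtain y where "y \<in> C" "\<not> sun5 (i + 5) y" using mx[of "i + 5"] i by auto
    then show False using i by (auto simp: sun5_def)
  qed
  then obtain x where x: "x \<in> C" "5 \<le> x" by auto
  then have x10: "x < 10" using sub by auto
  \<comment> \<open>These are the ends of the edge carrying \<open>x\<close>; \<open>x - 4\<close>
    is the successor of \<open>x - 5\<close>, reduced modulo 5 for \<open>x = 9\<close>.\<close>
  have xadj: "sun5 x y \<longleftrightarrow> y = x - 5 \<or> y = (x - 4) mod 5" for y
    using x x10 by (auto simp: sun5_def)
  have cyc: "sun5 (x - 5) ((x - 4) mod 5)" "sun5 ((x - 4) mod 5) (x - 5)"
  proof -
    have "sun5 i ((i + 1) mod 5) \<and> sun5 ((i + 1) mod 5) i" if "i < 5" for i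
      using that by (simp add: sun5_def cycle5_def)
    from this[of "x - 5"] show "sun5 (x - 5) ((x - 4) mod 5)" "sun5 ((x - 4) mod 5) (x - 5)"
      using x x10 by (simp_all add: Suc_diff_le flip: Suc_diff_Suc)
  qed
  \<comment> \<open>Members of \<open>C\<close> other than \<open>x\<close> are among the two
    neighbours of \<open>x\<close>, which are adjacent to each other; so either neighbour is
    compatible with all of \<open>C\<close>.\<close>
  have "y \<in> C" if y: "sun5 x y" "y < 10" for y
  proof (rule ccontr)
    assume "y \<notin> C"
    then obtain z where z: "z \<in> C" "\<not> sun5 y z" using mx y by blast
    have "sun5 y x" using symp_sun5 y(1) by (rule sympD)
    then have "z \<noteq> x" using z by auto
    then have "sun5 x z" using pw x z by (auto simp: pairwise_def)
    moreover have "y \<noteq> z" using z \<open>y \<notin> C\<close> by auto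
    ultimately show False using xadj y z cyc by metis
  qed
  then show "\<exists>x\<in>C. \<forall>y\<in>{..<10}. sun5 x y \<longrightarrow> y \<in> C" using x by auto
qed

section \<open>Blowing up the cycle vertices\<close>

text \<open>Any \<open>N \<ge> 21\<close> satisfies \<open>5 N\<^sup>2 + 5 > (2 N + 5)\<^sup>2\<close>; here \<open>N = 30\<close>.\<close>

definition blowup_weight :: "nat \<Rightarrow> nat" where
  "blowup_weight v = (if v < 5 then 30 else 1)"

text \<open>65 = 2 * 30 + 5: at most two cycle vertices of weight 30 and at most five attached
  vertices of weight 1. The same crude count serves for cliques and stable sets.\<close>

lemma sum_blowup_weight_le:
  assumes "D \<subseteq> {..<10}" and "card (D \<inter> {..<5}) \<le> 2"
  shows "sum blowup_weight D \<le> 65"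
proof -
  have fin: "finite D" using assms(1) finite_subset by blast
  have "sum blowup_weight D = sum blowup_weight (D \<inter> {..<5}) + sum blowup_weight (D - {..<5})"
    using fin by (rule sum.Int_Diff)
  also have "sum blowup_weight (D \<inter> {..<5}) = 30 * card (D \<inter> {..<5})"
    by (simp add: blowup_weight_def)
  also have "sum blowup_weight (D - {..<5}) = card (D - {..<5})"
    by (simp add: blowup_weight_def)
  finally have "sum blowup_weight D = 30 * card (D \<inter> {..<5}) + card (D - {..<5})" .
  moreover have "card (D - {..<5}) \<le> card {5..<10::nat}"
    using assms(1) by (intro card_mono) auto
  ultimately show ?thesis using assms(2) by simp
qed

text \<open>A vertex \<open>(v, i, j)\<close> is vertex \<open>j\<close> of copy \<open>i\<close> of
  the complete graph in the fibre over \<open>v\<close>; over an attached vertex the fibre is one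
  point. In a fibre a maximal clique is an entire copy and a maximal stable set meets every
  copy.\<close>

lemma bounded_cis_sun5_blowup:
  "bounded_cis (SIGMA v:{..<10}. {..<blowup_weight v} \<times> {..<blowup_weight v})
     (\<lambda>x y. if fst x = fst y then fst (snd x) = fst (snd y) else sun5 (fst x) (fst y)) 65 65"
  (is "bounded_cis ?U ?R _ _")
proof -
  have fin: "finite ?U" by auto
  have pos: "blowup_weight v > 0" for v by (simp add: blowup_weight_def)
  have onto: "fst ` ?U = {..<10}" using pos by force
  have "cis_on ?U ?R"
  proof (rule cis_on_quotient[where p = fst and A = sun5, OF cis_on_sun5 onto])
    fix v :: nat assume v: "v \<in> {..<10}"
    let ?F = "{x \<in> ?U. fst x = v}"
    show "cis_on ?F ?R"
      unfolding cis_on_def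
    proof (intro allI impI)
      fix C S
      assume C: "max_pairwise ?F ?R C" and S: "max_pairwise ?F (\<lambda>x y. \<not> ?R x y) S"
      have "(v, 0, 0) \<in> ?F" using v pos by auto
      then have "C \<noteq> {}" using C unfolding max_pairwise_def by blast
      then obtain c where c: "c \<in> C" by auto
      then have cF: "c \<in> ?F" using C by (auto simp: max_pairwise_def)
      have "\<exists>y\<in>S. fst (snd c) = fst (snd y)"
      proof (cases "c \<in> S")
        case False
        then obtain y where y: "y \<in> S" "?R c y"
          using S cF unfolding max_pairwise_def by blast
        moreover have "y \<in> ?F" using S y by (auto simp: max_pairwise_def)
        ultimately show ?thesis using cF by auto
      qed auto
      then obtain y where y: "y \<in> S" "fst (snd c) = fst (snd y)" by auto
      have yF: "y \<in> ?F" using S y by (auto simp: max_pairwise_def)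
      \<comment> \<open>\<open>C\<close> lies within the copy of \<open>c\<close>, so
        \<open>y\<close> is adjacent to every other member of \<open>C\<close>.\<close>
      have "y \<in> C"
      proof (rule ccontr)
        assume "y \<notin> C"
        then obtain z where z: "z \<in> C" "\<not> ?R y z"
          using C yF unfolding max_pairwise_def by blast
        have zF: "z \<in> ?F" using C z by (auto simp: max_pairwise_def)
        have "c \<noteq> z" using z y cF yF by auto
        then have "?R c z" using C c z unfolding max_pairwise_def pairwise_def by blast
        then show False using z y cF yF zF by auto
      qed
      then show "C \<inter> S \<noteq> {}" using y by auto
    qed
  qed auto
  moreover have "symp ?R" using symp_sun5 by (auto simp: symp_def)
  moreover have "card C \<le> 65" if C: "C \<subseteq> ?U" "pairwise ?R C" for C
  proof (rule card_pairwise_quotient_le[where p = fst and A = sun5 and f = blowup_weight,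
        OF fin C onto])
    fix v D assume D: "D \<subseteq> {x \<in> ?U. fst x = v}" "pairwise ?R D"
    \<comment> \<open>A clique in a fibre stays in one copy, so the position within the copy
      separates its vertices.\<close>
    have "inj_on (snd \<circ> snd) D"
    proof (rule inj_onI)
      fix x y assume xy: "x \<in> D" "y \<in> D" "(snd \<circ> snd) x = (snd \<circ> snd) y"
      then have "fst x = v" "fst y = v" using D(1) by blast+
      moreover have "x \<noteq> y \<Longrightarrow> ?R x y" using D(2) xy(1,2) by (rule pairwiseD)
      ultimately show "x = y" using xy by (auto simp: prod_eq_iff)
    qed
    moreover have "(snd \<circ> snd) ` D \<subseteq> {..<blowup_weight v}" using D(1) by auto
    ultimately show "card D \<le> blowup_weight v"
      using card_inj_on_le[of "snd \<circ> snd" D "{..<blowup_weight v}"] by simp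
  next
    fix D assume D: "D \<subseteq> {..<10}" "pairwise sun5 D"
    have "card (D \<inter> {..<5}) \<le> 2"
    proof (rule card_le_2_if_no_triple)
      fix u v w assume uvw: "u \<in> D \<inter> {..<5}" "v \<in> D \<inter> {..<5}" "w \<in> D \<inter> {..<5}"
        "u \<noteq> v" "u \<noteq> w" "v \<noteq> w"
      then have "sun5 u v" "sun5 u w" "sun5 v w" using D(2) by (auto dest: pairwiseD)
      then show False using cycle5_triple(1)[of u v w] uvw by (simp add: sun5_def)
    qed
    then show "sum blowup_weight D \<le> 65" using D(1) sum_blowup_weight_le by blast
  qed auto
  moreover have "card C \<le> 65" if C: "C \<subseteq> ?U" "pairwise (\<lambda>x y. \<not> ?R x y) C" for C
  proof (rule card_pairwise_quotient_le[where p = fst and A = "\<lambda>x y. \<not> sun5 x y"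
        and f = blowup_weight, OF fin C onto])
    fix v D assume D: "D \<subseteq> {x \<in> ?U. fst x = v}" "pairwise (\<lambda>x y. \<not> ?R x y) D"
    \<comment> \<open>A stable set takes at most one vertex from each copy, so the copy index
      separates its vertices.\<close>
    have "inj_on (fst \<circ> snd) D"
    proof (rule inj_onI)
      fix x y assume xy: "x \<in> D" "y \<in> D" "(fst \<circ> snd) x = (fst \<circ> snd) y"
      then have "fst x = v" "fst y = v" using D(1) by blast+
      moreover have "x \<noteq> y \<Longrightarrow> \<not> ?R x y" using D(2) xy(1,2) by (rule pairwiseD)
      ultimately show "x = y" using xy by auto
    qed
    moreover have "(fst \<circ> snd) ` D \<subseteq> {..<blowup_weight v}" using D(1) by auto
    ultimately show "card D \<le> blowup_weight v"
      using card_inj_on_le[of "fst \<circ> snd" D "{..<blowup_weight v}"] by simp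
  next
    fix D assume D: "D \<subseteq> {..<10}" "pairwise (\<lambda>x y. \<not> sun5 x y) D"
    have "card (D \<inter> {..<5}) \<le> 2"
    proof (rule card_le_2_if_no_triple)
      fix u v w assume uvw: "u \<in> D \<inter> {..<5}" "v \<in> D \<inter> {..<5}" "w \<in> D \<inter> {..<5}"
        "u \<noteq> v" "u \<noteq> w" "v \<noteq> w"
      then have "\<not> sun5 u v" "\<not> sun5 u w" "\<not> sun5 v w" using D(2) by (auto dest: pairwiseD)
      then show False using cycle5_triple(2)[of u v w] uvw by (simp add: sun5_def)
    qed
    then show "sum blowup_weight D \<le> 65" using D(1) sum_blowup_weight_le by blast
  qed auto
  ultimately show ?thesis using fin unfolding bounded_cis_def by blast
qed

text \<open>Five fibres of 30 * 30 vertices and five of one vertex give 5 * 900 + 5, which beats 65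
  * 65 = 4225.\<close>

lemma card_sun5_blowup:
  "card (SIGMA v:{..<10}. {..<blowup_weight v} \<times> {..<blowup_weight v}) = 4505"
proof -
  have "{..<10::nat} = {0,1,2,3,4,5,6,7,8,9}" by auto
  then show ?thesis by (simp add: blowup_weight_def)
qed

section \<open>Edge sets and the final estimate\<close>

lemma bounded_cis_imp_graph:
  assumes G: "bounded_cis V A s w"
  obtains E where "finite_simple_graph V E" "CIS V E"
    "stability_number V E \<le> s" "clique_number V E \<le> w"
proof
  let ?E = "{{x, y} |x y. x \<in> V \<and> y \<in> V \<and> x \<noteq> y \<and> A x y}"
  have fin: "finite V" and sym: "\<And>x y. A x y = A y x"
    using G by (auto simp: bounded_cis_def symp_def)
  have E: "{x, y} \<in> ?E \<longleftrightarrow> A x y" if "x \<in> V" "y \<in> V" "x \<noteq> y" for x y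
    using that sym by (auto simp: doubleton_eq_iff)
  have clique: "clique C ?E \<longleftrightarrow> pairwise A C" if "C \<subseteq> V" for C
    using E that unfolding clique_def pairwise_def by (meson subsetD)
  have indep: "indep C ?E \<longleftrightarrow> pairwise (\<lambda>x y. \<not> A x y) C" if "C \<subseteq> V" for C
    using E that unfolding indep_def pairwise_def by (meson subsetD)
  \<comment> \<open>Inclusion-maximality yields the one-vertex form, since a vertex related to all
    of \<open>C\<close> could be inserted. Symmetry of \<open>R\<close> enters because
    \<open>pairwise\<close> tests both orders.\<close>
  have maximal: "max_pairwise V R C"
    if "C \<subseteq> V" "pairwise R C" "\<And>D. D \<subseteq> V \<Longrightarrow> pairwise R D \<Longrightarrow> C \<subseteq> D \<Longrightarrow> D = C"
      and "\<And>x y. R x y = R y x" for R C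
    unfolding max_pairwise_def
  proof (intro conjI ballI that(1,2))
    fix x assume x: "x \<in> V - C"
    then have "insert x C \<noteq> C" by auto
    then have "\<not> pairwise R (insert x C)"
      using that(1,3) x by (metis Diff_iff insert_subset subset_insertI)
    then show "\<exists>y\<in>C. \<not> R x y" using that(2,4) by (auto simp: pairwise_insert)
  qed
  show "finite_simple_graph V ?E"
    using fin by (auto simp: finite_simple_graph_def nsets_def)
  show "CIS V ?E"
    unfolding CIS_def
  proof (intro allI impI, elim conjE)
    fix C S assume C: "maximal_clique V ?E C" and S: "maximal_stable_set V ?E S"
    have "max_pairwise V A C"
      using C sym clique by (intro maximal) (auto simp: maximal_clique_def)
    moreover have "max_pairwise V (\<lambda>x y. \<not> A x y) S"
      using S sym indep by (intro maximal) (auto simp: maximal_stable_set_def)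
    ultimately show "C \<inter> S \<noteq> {}" using G by (auto simp: bounded_cis_def cis_on_def)
  qed
  have Max_le: "Max {card C |C. C \<subseteq> V \<and> P C} \<le> b"
    if "\<And>C. C \<subseteq> V \<Longrightarrow> P C \<Longrightarrow> card C \<le> b" "P {}" for P b
  proof (rule Max.boundedI)
    show "finite {card C |C. C \<subseteq> V \<and> P C}" using fin by simp
    show "{card C |C. C \<subseteq> V \<and> P C} \<noteq> {}" using that(2) by auto
  qed (use that(1) in auto)
  show "stability_number V ?E \<le> s" unfolding stability_number_def
    by (rule Max_le) (use G indep in \<open>auto simp: bounded_cis_def indep_def\<close>)
  show "clique_number V ?E \<le> w" unfolding clique_number_def
    by (rule Max_le) (use G clique in \<open>auto simp: bounded_cis_def clique_def\<close>)
qed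

theorem theorem15:
  fixes k :: nat
  assumes "k > 0"
  shows "\<exists>(V :: nat set) (E :: nat set set).
           finite_simple_graph V E \<and> CIS V E \<and>
           card V > k * stability_number V E * clique_number V E"
proof -
  obtain W :: "nat set" and B where W: "bounded_cis W B 65 65" "card W = 4505"
    using bounded_cis_nat[OF bounded_cis_sun5_blowup] card_sun5_blowup by auto
  \<comment> \<open>With 4225 = 65 * 65, this quotient bounds the ratio of the starting graph from
    below; as it exceeds 1, some power of it exceeds \<open>k\<close>.\<close>
  obtain t where "real k < (4505 / 4225) ^ t"
    using real_arch_pow[of "4505 / 4225" "real k"] by auto
  moreover have "real k * b ^ t < a ^ t" if "real k < (a / b) ^ t" "b > 0" for a b :: real
    using that by (simp add: power_divide field_simps)
  ultimately have "real k * 4225 ^ t < 4505 ^ t" by simp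
  then have t: "k * 4225 ^ t < 4505 ^ t"
    by (metis (mono_tags, lifting) of_nat_less_iff of_nat_mult of_nat_numeral of_nat_power)
  obtain V :: "nat set" and A where V: "bounded_cis V A (65 ^ t) (65 ^ t)" "card V = 4505 ^ t"
    using bounded_cis_power[OF W(1), of t] W(2) by auto
  obtain E where E: "finite_simple_graph V E" "CIS V E"
    "stability_number V E \<le> 65 ^ t" "clique_number V E \<le> 65 ^ t"
    using bounded_cis_imp_graph[OF V(1)] by blast
  have "k * stability_number V E * clique_number V E \<le> k * 65 ^ t * 65 ^ t"
    using E(3,4) by (intro mult_le_mono) auto
  also have "\<dots> = k * 4225 ^ t" by (simp add: power_mult_distrib[symmetric] mult.assoc)
  also have "\<dots> < card V" using t V(2) by simp
  finally show ?thesis using E(1,2) by blast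
qed

end
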